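(* Let $H\in\mathbb{R}^{n\times n}$ be a Hankel matrix with bit complexity $\ell$. There exists an algorithm that finds a representation of matrices $B$ and $C$, each with $n$ rows, $O(n\log n)$ columns, and bit complexity $\ell$, in time $\widetilde{O}(n\cdot \ell)$ such that $\|H-(BB^*-CC^* )\|_{F}<\frac{1}{2^{\ell}}$.
   Context: A Hankel matrix $H\in\mathbb{R}^{n\times n}$ is a matrix of the form $H_{ij}=h_{i+j-1}$ for a generating vector $(h_1,\ldots,h_{2n-1})\in\mathbb{R}^{2n-1}$; it is given as input by its generating vector. $\|\cdot\|_F$ is the Frobenius norm and $B^*$ is the conjugate transpose of $B$. The matrices $B$ and $C$ may have complex entries. Computation is in fixed-point arithmetic, and running time is measured in bit operations; bit complexity $\ell$ of a matrix refers to the number of bits used to represent its entries. The notation $\widetilde{O}(f)$ means $O(f\cdot\log^c(n\ell))$ for some constant $c$. The matrices $B$ and $C$ need not be output explicitly: a "representation" is an implicit description of size $\widetilde{O}(n\cdot\ell)$ that completely determines the matrix (in the same way that a Hankel matrix is completely described by its generating vector). *)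

theory Defs
  imports
    "HOL-Library.Landau_Symbols"
    "HOL-Library.Log_Nat"
    "Jordan_Normal_Form.Schur_Decomposition"
begin

text \<open>
  Machine model: a random access machine with logarithmic cost.  Registers and array cells hold
  integers of arbitrary size, and each instruction is charged the number of bits of the addresses
  and values that it handles, so that the total cost counts bit operations.  The only arithmetic
  operations are addition, subtraction and binary shifts, which are linear in the number of bits;
  there is no unit-cost (or linear-cost) multiplication.  Programs are finite, so a program can
  name only a fixed finite number of registers and arrays.
\<close>

datatype com =
    Const nat int          \<comment> \<open>\<open>x := c\<close>\<close>
  | Copy nat nat           \<comment> \<open>\<open>x := y\<close>\<close>
  | Add nat nat nat        \<comment> \<open>\<open>x := y + z\<close>\<close>
  | Sub nat nat nat        \<comment> \<open>\<open>x := y - z\<close>\<close>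
  | Shl nat nat nat        \<comment> \<open>\<open>x := y * 2 ^ z\<close>\<close>
  | Shr nat nat nat        \<comment> \<open>\<open>x := y div 2 ^ z\<close>, rounding down\<close>
  | Load nat nat nat       \<comment> \<open>\<open>x := a[y]\<close>\<close>
  | Store nat nat nat      \<comment> \<open>\<open>a[x] := y\<close>\<close>
  | Seq com com
  | IfPos nat com com      \<comment> \<open>test \<open>x > 0\<close>\<close>
  | WhilePos nat com       \<comment> \<open>test \<open>x > 0\<close>\<close>

type_synonym state = "(nat \<Rightarrow> int) \<times> (nat \<Rightarrow> nat \<Rightarrow> int)"

text \<open>Number of binary digits of the absolute value, plus one for the sign.\<close>

definition word_size :: "int \<Rightarrow> nat" where
  "word_size z = Suc (floorlog 2 (nat \<bar>z\<bar>))"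

text \<open>\<open>exec p st t st'\<close>: from \<open>st\<close>, program \<open>p\<close> terminates in \<open>st'\<close> at cost \<open>t\<close>.  A negative address
  or shift distance makes the program get stuck.\<close>

inductive exec :: "com \<Rightarrow> state \<Rightarrow> nat \<Rightarrow> state \<Rightarrow> bool" where
  exec_Const: "exec (Const x c) (s, m) (word_size c) (s(x := c), m)"
| exec_Copy: "exec (Copy x y) (s, m) (word_size (s y)) (s(x := s y), m)"
| exec_Add: "exec (Add x y z) (s, m) (word_size (s y) + word_size (s z)) (s(x := s y + s z), m)"
| exec_Sub: "exec (Sub x y z) (s, m) (word_size (s y) + word_size (s z)) (s(x := s y - s z), m)"
| exec_Shl: "0 \<le> s z \<Longrightarrow>
    exec (Shl x y z) (s, m)
      (word_size (s y) + word_size (s z) + word_size (s y * 2 ^ nat (s z)))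
      (s(x := s y * 2 ^ nat (s z)), m)"
| exec_Shr: "0 \<le> s z \<Longrightarrow>
    exec (Shr x y z) (s, m) (word_size (s y) + word_size (s z)) (s(x := s y div 2 ^ nat (s z)), m)"
| exec_Load: "0 \<le> s y \<Longrightarrow>
    exec (Load x a y) (s, m) (word_size (s y) + word_size (m a (nat (s y))))
      (s(x := m a (nat (s y))), m)"
| exec_Store: "0 \<le> s x \<Longrightarrow>
    exec (Store a x y) (s, m) (word_size (s x) + word_size (s y))
      (s, m(a := (m a)(nat (s x) := s y)))"
| exec_Seq: "exec p st t st' \<Longrightarrow> exec q st' t' st'' \<Longrightarrow> exec (Seq p q) st (t + t') st''"
| exec_IfPos_True: "0 < s x \<Longrightarrow> exec p (s, m) t st \<Longrightarrow>
    exec (IfPos x p q) (s, m) (word_size (s x) + t) st"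
| exec_IfPos_False: "\<not> 0 < s x \<Longrightarrow> exec q (s, m) t st \<Longrightarrow>
    exec (IfPos x p q) (s, m) (word_size (s x) + t) st"
| exec_WhilePos_True: "0 < s x \<Longrightarrow> exec p (s, m) t st \<Longrightarrow> exec (WhilePos x p) st t' st' \<Longrightarrow>
    exec (WhilePos x p) (s, m) (word_size (s x) + t + t') st'"
| exec_WhilePos_False: "\<not> 0 < s x \<Longrightarrow> exec (WhilePos x p) (s, m) (word_size (s x)) (s, m)"

text \<open>A list of words occupies an array with its length in cell \<open>0\<close> and its elements from cell \<open>1\<close> on.\<close>

definition array_of :: "int list \<Rightarrow> nat \<Rightarrow> int" where
  "array_of ws k = (if k = 0 then int (length ws) else if k \<le> length ws then ws ! (k - 1) else 0)"

definition init_state :: "int list list \<Rightarrow> state" where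
  "init_state ins = (\<lambda>_. 0, \<lambda>a. array_of (if a < length ins then ins ! a else []))"

text \<open>Inputs are loaded into, and outputs are read from, the arrays \<open>0, 1, \<dots>\<close>.\<close>

definition runs :: "com \<Rightarrow> int list list \<Rightarrow> int list list \<Rightarrow> nat \<Rightarrow> bool" where
  "runs p ins outs t \<longleftrightarrow> (\<exists>s m. exec p (init_state ins) t (s, m) \<and>
     (\<forall>a < length outs. \<forall>k \<le> length (outs ! a). m a k = array_of (outs ! a) k))"

text \<open>\<open>soft_O g\<close> are the functions of \<open>n, l \<ge> 1\<close> bounded by \<open>g n l\<close> up to a factor polylogarithmic
  in \<open>n * l\<close>.  The \<open>+ 1\<close> only keeps the logarithm from vanishing at \<open>n = l = 1\<close>.\<close>

definition soft_O :: "(nat \<Rightarrow> nat \<Rightarrow> real) \<Rightarrow> (nat \<Rightarrow> nat \<Rightarrow> real) set" where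
  "soft_O g = {T. \<exists>(K::real) (c::nat). \<forall>n \<ge> 1. \<forall>l \<ge> 1.
     T n l \<le> K * g n l * log 2 (real (n * l) + 1) ^ c}"

text \<open>Fixed-point numbers with \<open>l\<close> bits and a sign, \<open>f\<close> of the bits being after the binary point.\<close>

definition fixed_point :: "nat \<Rightarrow> nat \<Rightarrow> real \<Rightarrow> bool" where
  "fixed_point l f x \<longleftrightarrow> (\<exists>k::int. x = of_int k / 2 ^ f \<and> \<bar>k\<bar> < 2 ^ l)"

definition bit_complexity :: "nat \<Rightarrow> nat \<Rightarrow> complex mat \<Rightarrow> bool" where
  "bit_complexity l f M \<longleftrightarrow> (\<forall>i < dim_row M. \<forall>j < dim_col M.
     fixed_point l f (Re (M $$ (i, j))) \<and> fixed_point l f (Im (M $$ (i, j))))"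

text \<open>Rows, columns and the generating vector are indexed from \<open>0\<close>, so that \<open>h\<^bsub>i+j-1\<^esub>\<close> in indices
  starting from \<open>1\<close> becomes \<open>h $ (i + j)\<close>.\<close>

definition hankel :: "nat \<Rightarrow> real vec \<Rightarrow> complex mat" where
  "hankel n h = mat n n (\<lambda>(i, j). complex_of_real (h $ (i + j)))"

definition frobenius_norm :: "complex mat \<Rightarrow> real" where
  "frobenius_norm M = sqrt (\<Sum>i < dim_row M. \<Sum>j < dim_col M. (cmod (M $$ (i, j)))\<^sup>2)"

text \<open>The input is the fixed-point format and the generating vector.  The floor is exact when the
  entries of \<open>h\<close> are fixed-point numbers of that format.\<close>

definition hankel_input :: "nat \<Rightarrow> nat \<Rightarrow> nat \<Rightarrow> real vec \<Rightarrow> int list list" where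
  "hankel_input n l f h = [[int n, int l, int f], map (\<lambda>x. \<lfloor>x * 2 ^ f\<rfloor>) (list_of_vec h)]"

text \<open>The word list \<open>r\<close> represents \<open>M\<close> with respect to a decoding program \<open>D\<close>: like a Hankel matrix
  from its generating vector, each entry of \<open>M\<close> can be read off exactly from \<open>r\<close> and its position,
  at cost at most \<open>q\<close>.\<close>

definition represents :: "com \<Rightarrow> nat \<Rightarrow> real \<Rightarrow> int list \<Rightarrow> complex mat \<Rightarrow> bool" where
  "represents D f q r M \<longleftrightarrow> (\<forall>i < dim_row M. \<forall>j < dim_col M. \<exists>x y t.
     M $$ (i, j) = Complex (of_int x / 2 ^ f) (of_int y / 2 ^ f) \<and>
     runs D [r, [int i, int j]] [[x, y]] t \<and> real t \<le> q)"

definition rep_size :: "int list \<Rightarrow> nat" where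
  "rep_size r = sum_list (map word_size r)"

end

theory Submission
  imports Defs
begin

text \<open>
  There is an exact decomposition, computed entry by entry.  Let \<open>K\<close> be the integer matrix
  \<open>2 ^ f H\<close>, and write \<open>K = X + X\<^sup>T + D\<close> with \<open>X\<close> integral and upper triangular (the diagonal of \<open>X\<close>
  is that of \<open>K\<close> halved and rounded down) and \<open>D\<close> diagonal with entries in \<open>{0, 1}\<close>.
  For \<open>|w|\<^sup>2 a = 2 ^ f\<close>, the columns \<open>x\<^sub>j\<close> of \<open>X\<close> satisfy
  \<open>w (x\<^sub>j + a e\<^sub>j) (w (x\<^sub>j + a e\<^sub>j))\<^sup>* - w x\<^sub>j (w x\<^sub>j)\<^sup>* - w a e\<^sub>j (w a e\<^sub>j)\<^sup>* = 2 ^ f (x\<^sub>j e\<^sub>j\<^sup>T + e\<^sub>j x\<^sub>j\<^sup>T)\<close>,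
  and \<open>2 ^ f D\<close> is a Gram matrix because \<open>2 ^ f\<close> is the norm of a Gaussian integer.  Taking
  \<open>w = 1 + \<i>\<close>, \<open>a = 2 ^ (f - 1)\<close> (or \<open>w = a = 1\<close> if \<open>f = 0\<close>) avoids overflow even if \<open>f = l\<close>.
  The numerators of \<open>h\<close> and a few parameters then represent \<open>B\<close> and \<open>C\<close>.
\<close>

section \<open>Symbolic execution and cost of loop-free programs\<close>

text \<open>As a function, unlike \<open>exec\<close>, it lets the simplifier compute final states.
  It gives junk for stuck instructions and for loops; \<open>safe\<close> excludes both.\<close>

primrec eff :: "com \<Rightarrow> state \<Rightarrow> state" where
  "eff (Const x c) st = ((fst st)(x := c), snd st)"
| "eff (Copy x y) st = ((fst st)(x := fst st y), snd st)"
| "eff (Add x y z) st = ((fst st)(x := fst st y + fst st z), snd st)"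
| "eff (Sub x y z) st = ((fst st)(x := fst st y - fst st z), snd st)"
| "eff (Shl x y z) st = ((fst st)(x := fst st y * 2 ^ nat (fst st z)), snd st)"
| "eff (Shr x y z) st = ((fst st)(x := fst st y div 2 ^ nat (fst st z)), snd st)"
| "eff (Load x a y) st = ((fst st)(x := snd st a (nat (fst st y))), snd st)"
| "eff (Store a x y) st =
     (fst st, (snd st)(a := (snd st a)(nat (fst st x) := fst st y)))"
| "eff (Seq p q) st = eff q (eff p st)"
| "eff (IfPos x p q) st = (if 0 < fst st x then eff p st else eff q st)"
| "eff (WhilePos x p) st = st"

text \<open>\<open>safe N p st\<close>: the loop-free program \<open>p\<close> does not get stuck from \<open>st\<close> and handles only
  words of absolute value at most \<open>N\<close>.\<close>

primrec safe :: "int \<Rightarrow> com \<Rightarrow> state \<Rightarrow> bool" where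
  "safe N (Const x c) st \<longleftrightarrow> \<bar>c\<bar> \<le> N"
| "safe N (Copy x y) st \<longleftrightarrow> \<bar>fst st y\<bar> \<le> N"
| "safe N (Add x y z) st \<longleftrightarrow> \<bar>fst st y\<bar> \<le> N \<and> \<bar>fst st z\<bar> \<le> N"
| "safe N (Sub x y z) st \<longleftrightarrow> \<bar>fst st y\<bar> \<le> N \<and> \<bar>fst st z\<bar> \<le> N"
| "safe N (Shl x y z) st \<longleftrightarrow> 0 \<le> fst st z \<and> \<bar>fst st y\<bar> \<le> N \<and> \<bar>fst st z\<bar> \<le> N \<and>
     \<bar>fst st y * 2 ^ nat (fst st z)\<bar> \<le> N"
| "safe N (Shr x y z) st \<longleftrightarrow> 0 \<le> fst st z \<and> \<bar>fst st y\<bar> \<le> N \<and> \<bar>fst st z\<bar> \<le> N"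
| "safe N (Load x a y) st \<longleftrightarrow> 0 \<le> fst st y \<and> \<bar>fst st y\<bar> \<le> N \<and>
     \<bar>snd st a (nat (fst st y))\<bar> \<le> N"
| "safe N (Store a x y) st \<longleftrightarrow> 0 \<le> fst st x \<and> \<bar>fst st x\<bar> \<le> N \<and> \<bar>fst st y\<bar> \<le> N"
| "safe N (Seq p q) st \<longleftrightarrow> safe N p st \<and> safe N q (eff p st)"
| "safe N (IfPos x p q) st \<longleftrightarrow> \<bar>fst st x\<bar> \<le> N \<and>
     (if 0 < fst st x then safe N p st else safe N q st)"
| "safe N (WhilePos x p) st \<longleftrightarrow> False"

primrec com_length :: "com \<Rightarrow> nat" where
  "com_length (Const x c) = 1"
| "com_length (Copy x y) = 1"
| "com_length (Add x y z) = 1"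
| "com_length (Sub x y z) = 1"
| "com_length (Shl x y z) = 1"
| "com_length (Shr x y z) = 1"
| "com_length (Load x a y) = 1"
| "com_length (Store a x y) = 1"
| "com_length (Seq p q) = com_length p + com_length q"
| "com_length (IfPos x p q) = 1 + com_length p + com_length q"
| "com_length (WhilePos x p) = 1 + com_length p"

lemma word_size_mono: "\<bar>a\<bar> \<le> b \<Longrightarrow> word_size a \<le> word_size b"
  unfolding word_size_def by (auto intro!: floorlog_mono nat_mono)

text \<open>The factor 3 is the largest number of words charged for one instruction, attained by
  \<open>Shl\<close>. A fixed loop-free program thus has cost linear in the length of the largest
  word.\<close>

lemma exec_eff:
  "safe N p st \<Longrightarrow> \<exists>t \<le> com_length p * (3 * word_size N). exec p st t (eff p st)"
proof (induction p arbitrary: st)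
  case (Const x c)
  obtain s m where [simp]: "st = (s, m)" by (cases st)
  show ?case using Const word_size_mono[of c N]
    by (intro exI[of _ "word_size c"]) (simp add: exec_Const)
next
  case (Copy x y)
  obtain s m where [simp]: "st = (s, m)" by (cases st)
  show ?case using Copy word_size_mono[of "s y" N]
    by (intro exI[of _ "word_size (s y)"]) (simp add: exec_Copy)
next
  case (Add x y z)
  obtain s m where [simp]: "st = (s, m)" by (cases st)
  show ?case
    using Add word_size_mono[of "s y" N] word_size_mono[of "s z" N]
    by (intro exI[of _ "word_size (s y) + word_size (s z)"]) (simp add: exec_Add)
next
  case (Sub x y z)
  obtain s m where [simp]: "st = (s, m)" by (cases st)
  show ?case
    using Sub word_size_mono[of "s y" N] word_size_mono[of "s z" N]
    by (intro exI[of _ "word_size (s y) + word_size (s z)"]) (simp add: exec_Sub)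
next
  case (Shl x y z)
  obtain s m where [simp]: "st = (s, m)" by (cases st)
  have "word_size (s y) \<le> word_size N" "word_size (s z) \<le> word_size N" "word_size (s y * 2 ^ nat (s z)) \<le> word_size N"
    using Shl by (auto intro!: word_size_mono)
  then show ?case using Shl
    by (intro exI[of _ "word_size (s y) + word_size (s z) + word_size (s y * 2 ^ nat (s z))"])
      (simp add: exec_Shl)
next
  case (Shr x y z)
  obtain s m where [simp]: "st = (s, m)" by (cases st)
  have "word_size (s y) \<le> word_size N" "word_size (s z) \<le> word_size N"
    using Shr by (auto intro!: word_size_mono)
  then show ?case using Shr
    by (intro exI[of _ "word_size (s y) + word_size (s z)"]) (simp add: exec_Shr)
next
  case (Load x a y)
  obtain s m where [simp]: "st = (s, m)" by (cases st)
  have "word_size (s y) \<le> word_size N" "word_size (m a (nat (s y))) \<le> word_size N"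
    using Load by (auto intro!: word_size_mono)
  then show ?case using Load
    by (intro exI[of _ "word_size (s y) + word_size (m a (nat (s y)))"]) (simp add: exec_Load)
next
  case (Store a x y)
  obtain s m where [simp]: "st = (s, m)" by (cases st)
  have "word_size (s x) \<le> word_size N" "word_size (s y) \<le> word_size N"
    using Store by (auto intro!: word_size_mono)
  then show ?case using Store
    by (intro exI[of _ "word_size (s x) + word_size (s y)"]) (simp add: exec_Store)
next
  case (Seq p q)
  from Seq.prems have "safe N p st" "safe N q (eff p st)" by auto
  with Seq.IH obtain t t' where
    "t \<le> com_length p * (3 * word_size N)" "exec p st t (eff p st)"
    "t' \<le> com_length q * (3 * word_size N)" "exec q (eff p st) t' (eff q (eff p st))" by blast
  then show ?case
    by (intro exI[of _ "t + t'"]) (auto simp: add_mult_distrib intro: exec_Seq)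
next
  case (IfPos x p q)
  obtain s m where [simp]: "st = (s, m)" by (cases st)
  have w: "word_size (s x) \<le> word_size N" using IfPos.prems by (auto intro: word_size_mono)
  show ?case
  proof (cases "0 < s x")
    case True
    with IfPos.prems IfPos.IH(1)[of st] obtain t where
      "t \<le> com_length p * (3 * word_size N)" "exec p st t (eff p st)" by auto
    with True w show ?thesis
      by (intro exI[of _ "word_size (s x) + t"])
        (auto simp: add_mult_distrib intro!: exec_IfPos_True)
  next
    case False
    with IfPos.prems IfPos.IH(2)[of st] obtain t where
      "t \<le> com_length q * (3 * word_size N)" "exec q st t (eff q st)" by auto
    with False w show ?thesis
      by (intro exI[of _ "word_size (s x) + t"])
        (auto simp: add_mult_distrib intro!: exec_IfPos_False)
  qed
qed simp

section \<open>Decoding a single matrix entry\<close>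

primrec seqs :: "com list \<Rightarrow> com" where
  "seqs [] = Copy 0 0"
| "seqs (p # ps) = Seq p (seqs ps)"

abbreviation skip :: com where "skip \<equiv> Copy 0 0"

text \<open>Numerators of entry \<open>(i, c)\<close> of the matrix represented by \<open>ks @ [s, \<alpha>, u, v, g]\<close>.  Column \<open>2 j\<close>
  is \<open>(1 + s \<i>) (x\<^sub>j + \<alpha> e\<^sub>j)\<close> with \<open>s \<in> {0, 1}\<close>; column \<open>2 j + 1\<close> is \<open>(u + v \<i>) e\<^sub>j\<close>, unless \<open>g = 0\<close> and
  the \<open>j\<close>-th diagonal entry is even, when it vanishes.\<close>

definition entry :: "int list \<Rightarrow> int \<Rightarrow> int \<Rightarrow> int \<Rightarrow> int \<Rightarrow> int \<Rightarrow> nat \<Rightarrow> nat \<Rightarrow> int \<times> int" where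
  "entry ks s \<alpha> u v g i c =
    (let j = c div 2;
         x = (if i < j then ks ! (i + j) else if i = j then ks ! (i + j) div 2 + \<alpha> else 0)
     in if even c then (x, if s > 0 then x else 0)
        else if i = j \<and> ks ! (i + j) mod 2 + g > 0 then (u, v) else (0, 0))"

text \<open>Registers: 2 is \<open>i\<close>; 6 to 10 are \<open>g, v, u, \<alpha>, s\<close>; 11 and 12 are \<open>j\<close> and the parity of \<open>c\<close>;
  17 and 18 are \<open>ks ! (i + j)\<close> and its half; 14 and 15 receive the result.  Register 0 stays zero.\<close>

definition decoder_read :: com where
  "decoder_read = seqs [Const 1 1, Load 2 1 1, Const 3 2, Load 4 1 3,
    Load 5 0 0, Load 6 0 5, Sub 5 5 1, Load 7 0 5, Sub 5 5 1, Load 8 0 5,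
    Sub 5 5 1, Load 9 0 5, Sub 5 5 1, Load 10 0 5,
    Shr 11 4 1, Sub 12 4 11, Sub 12 12 11,
    Sub 13 11 2, Sub 20 2 11, Add 16 2 11, Add 16 16 1, Load 17 0 16, Shr 18 17 1,
    Sub 19 17 18, Sub 19 19 18, Add 19 19 6, Add 21 18 9]"

text \<open>Registers 13 and 20 hold \<open>j - i\<close> and \<open>i - j\<close>, so
  \<open>i = j\<close> is the case where both tests fail. Registers 14 and 15 start at zero, which
  supplies every vanishing entry. The result overwrites array 0, which has been read by
  then.\<close>

definition decoder_write :: com where
  "decoder_write = seqs [
    IfPos 12
      (IfPos 13 skip (IfPos 20 skip (IfPos 19 (Seq (Copy 14 8) (Copy 15 7)) skip)))
      (Seq (IfPos 13 (Copy 14 17) (IfPos 20 skip (Copy 14 21))) (IfPos 10 (Copy 15 14) skip)),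
    Store 0 1 14, Store 0 3 15, Store 0 0 3]"

definition decoder :: com where
  "decoder = Seq decoder_read decoder_write"

lemma array_of_left: "k < length ks \<Longrightarrow> array_of (ks @ ps) (Suc k) = ks ! k"
  by (simp add: array_of_def nth_append)

lemma array_of_right:
  "k = length ks + Suc d \<Longrightarrow> d < length ps \<Longrightarrow> array_of (ks @ ps) k = ps ! d"
  by (simp add: array_of_def nth_append)

text \<open>The factor 2 in \<open>bnd\<close> keeps sums of two words, such as
  \<open>k div 2 + \<alpha>\<close>, within \<open>N\<close>; the bound on \<open>n\<close> covers
  the addresses.\<close>

lemma decoder_correct:
  fixes N :: int
  assumes len: "length ks = 2 * n - 1" and n: "n \<ge> 1" and i: "i < n" and c: "c < 2 * n"
    and bnd: "\<And>z. z \<in> set (ks @ [s, \<alpha>, u, v, g]) \<Longrightarrow> 2 * \<bar>z\<bar> \<le> N"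
    and N: "4 * int n + 4 \<le> N"
  shows "\<exists>t \<le> com_length decoder * (3 * word_size N).
    runs decoder [ks @ [s, \<alpha>, u, v, g], [int i, int c]]
      [[fst (entry ks s \<alpha> u v g i c), snd (entry ks s \<alpha> u v g i c)]] t"
proof -
  define r where "r = ks @ [s, \<alpha>, u, v, g]"
  define j where "j = c div 2"
  define p where "p = c mod 2"
  have c_eq: "c = 2 * j + p" and p: "p = 0 \<or> p = 1" unfolding j_def p_def by auto
  have j: "j < n" using c unfolding j_def by linarith
  define k where "k = ks ! (i + j)"
  have ij: "i + j < length ks" using i j len n by linarith
  \<comment> \<open>The numerators fill cells \<open>1\<close> to \<open>2 * n - 1\<close>, hence
    the parameters occupy cells \<open>2 * n\<close> to \<open>2 * n + 4\<close>. The decoder finds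
    them by counting down from the length in cell 0.\<close>
  have m: "array_of r 0 = 2 * int n + 4" "array_of r (nat (2 * int n + 4)) = g"
    "array_of r (nat (3 + 2 * int n)) = v" "array_of r (nat (2 + 2 * int n)) = u"
    "array_of r (nat (1 + 2 * int n)) = \<alpha>" "array_of r (nat (2 * int n)) = s"
    "array_of r (nat (int i + int j + 1)) = k"
  proof -
    have *: "array_of r q = [s, \<alpha>, u, v, g] ! d" if "q = 2 * n + d" "d < 5" for q d
      using that len n unfolding r_def by (intro array_of_right) auto
    have nat4: "nat (2 * int n + 4) = 2 * n + 4" and nat3: "nat (3 + 2 * int n) = 2 * n + 3"
      and nat2: "nat (2 + 2 * int n) = 2 * n + 2" and nat1: "nat (1 + 2 * int n) = 2 * n + 1"
      and nat0: "nat (2 * int n) = 2 * n"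
      by arith+
    show "array_of r 0 = 2 * int n + 4" using len n by (simp add: r_def array_of_def)
    show "array_of r (nat (2 * int n + 4)) = g" using *[of "nat (2 * int n + 4)" 4] nat4 by simp
    show "array_of r (nat (3 + 2 * int n)) = v" using *[of "nat (3 + 2 * int n)" 3] nat3 by simp
    show "array_of r (nat (2 + 2 * int n)) = u" using *[of "nat (2 + 2 * int n)" 2] nat2 by simp
    show "array_of r (nat (1 + 2 * int n)) = \<alpha>" using *[of "nat (1 + 2 * int n)" 1] nat1 by simp
    show "array_of r (nat (2 * int n)) = s" using *[of "2 * n" 0] nat0 by simp
    show "array_of r (nat (int i + int j + 1)) = k"
      using array_of_left[OF ij, of "[s, \<alpha>, u, v, g]"] by (simp add: r_def k_def nat_add_distrib)
  qed
  have b: "2 * \<bar>s\<bar> \<le> N" "2 * \<bar>\<alpha>\<bar> \<le> N" "2 * \<bar>u\<bar> \<le> N" "2 * \<bar>v\<bar> \<le> N" "2 * \<bar>g\<bar> \<le> N" "2 * \<bar>k\<bar> \<le> N"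
    using bnd ij by (auto simp: k_def)
  define s1 :: "nat \<Rightarrow> int" where "s1 = (\<lambda>_. 0)"
  define m1 where "m1 = (\<lambda>a. array_of (if a < Suc (Suc 0) then [r, [int i, int c]] ! a else []))"
  have m1: "m1 0 = array_of r" "m1 (Suc 0) (Suc 0) = int i" "m1 (Suc 0) 2 = 2 * int j + int p"
    by (auto simp: m1_def array_of_def c_eq)
  have init: "init_state [r, [int i, int c]] = (s1, m1)"
    by (simp add: init_state_def s1_def m1_def)
  have s1: "\<And>x. s1 x = 0" by (simp add: s1_def)
  have div: "(2 * int j + int p) div 2 = int j" using p by auto
  \<comment> \<open>There is no remainder instruction: the program obtains the parity as
    \<open>k - k2 - k2\<close>.\<close>
  define k2 where "k2 = k div 2"
  have k2: "- N \<le> 2 * k2" "2 * k2 \<le> N" "k - k2 - k2 = k mod 2" "0 \<le> k mod 2" "k mod 2 \<le> 1"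
    "k div 2 = k2" "\<bar>k - k2\<bar> \<le> N"
    using b(6) unfolding k2_def by presburger+
  have weaken: "\<bar>z\<bar> \<le> N" if "2 * \<bar>z\<bar> \<le> N" for z using that by arith
  have a: "\<bar>s\<bar> \<le> N" "\<bar>\<alpha>\<bar> \<le> N" "\<bar>u\<bar> \<le> N" "\<bar>v\<bar> \<le> N" "\<bar>g\<bar> \<le> N" "\<bar>k\<bar> \<le> N"
    using b by (blast intro: weaken)+
  have N8: "8 \<le> N" using N n by simp
  have a2: "\<bar>k2\<bar> \<le> N" using k2(1,2) by arith
  have a3: "\<bar>k2 + \<alpha>\<bar> \<le> N" using k2(1,2) b(2) by arith
  have a4: "\<bar>k mod 2\<bar> \<le> N" "k mod 2 \<le> N" using k2(4,5) N8 by arith+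
  have a5: "\<bar>k mod 2 + g\<bar> \<le> N" using k2(4,5) b(5) N8 by arith
  note a = a a2 a3 a4 a5
  have ad: "1 \<le> N" "2 \<le> N" "2 * int n + 4 \<le> N" "3 + 2 * int n \<le> N" "2 + 2 * int n \<le> N" "1 + 2 * int n \<le> N"
    "2 * int n \<le> N" "2 * int j + int p \<le> N" "int j \<le> N" "int p \<le> N" "int i \<le> N" "int j + int p \<le> N"
    "int i + int j \<le> N" "int i + int j + 1 \<le> N" "int i - int j \<le> N" "\<bar>int j - int i\<bar> \<le> N" "\<bar>int i - int j\<bar> \<le> N" "0 \<le> N"
    using N i j n p by auto
  have sf1: "safe N decoder_read (s1, m1)"
    by (simp add: decoder_read_def s1 m1 m div k2) (simp add: a ad)
  \<comment> \<open>Keeping \<open>s2\<close> opaque, with only the listed register values, spares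
    the evaluation of \<open>decoder_write\<close> the long nest of updates.\<close>
  define s2 where "s2 = fst (eff decoder_read (s1, m1))"
  have e: "eff decoder_read (s1, m1) = (s2, m1)"
    unfolding s2_def by (simp add: decoder_read_def)
  have s2: "s2 0 = 0" "s2 (Suc 0) = 1" "s2 3 = 2" "s2 6 = g" "s2 7 = v" "s2 8 = u" "s2 9 = \<alpha>" "s2 10 = s"
    "s2 12 = int p" "s2 13 = int j - int i" "s2 20 = int i - int j" "s2 17 = k" "s2 18 = k2"
    "s2 19 = k mod 2 + g" "s2 21 = k2 + \<alpha>" "s2 14 = 0" "s2 15 = 0"
    unfolding s2_def by (simp_all add: decoder_read_def s1 m1 m div k2)
  have sf2: "safe N decoder_write (s2, m1)"
    using p by (auto simp: decoder_write_def s2 a ad abs_le_D1[OF a(1)] abs_le_D2[OF a(1)])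
  define x y where "x = fst (entry ks s \<alpha> u v g i c)" and "y = snd (entry ks s \<alpha> u v g i c)"
  have xy: "entry ks s \<alpha> u v g i c = (x, y)" by (simp add: x_def y_def)
  have out: "snd (eff decoder_write (s2, m1)) 0 q = array_of [x, y] q" if "q \<le> 2" for q
  proof -
    have "snd (eff decoder_write (s2, m1)) 0 = (m1 0)(1 := x, 2 := y, 0 := 2)"
      using p xy by (auto simp: decoder_write_def s2 entry_def Let_def c_eq k_def k2_def)
    moreover have "q = 0 \<or> q = 1 \<or> q = 2" using that by auto
    ultimately show ?thesis by (auto simp: array_of_def)
  qed
  from sf1 sf2 have "safe N decoder (s1, m1)" by (simp add: decoder_def e)
  from exec_eff[OF this] obtain t where t: "t \<le> com_length decoder * (3 * word_size N)"
    "exec decoder (s1, m1) t (eff decoder_write (s2, m1))" by (auto simp: decoder_def e)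
  have "runs decoder [r, [int i, int c]] [[x, y]] t"
    unfolding runs_def init using t(2) out
    by (intro exI[of _ "fst (eff decoder_write (s2, m1))"] exI[of _ "snd (eff decoder_write (s2, m1))"])
      simp
  with t(1) show ?thesis unfolding x_def y_def r_def by blast
qed

section \<open>Encoding: copying the numerators and appending the parameters\<close>

definition copy_loop :: com where
  "copy_loop = WhilePos 5 (seqs [Load 6 1 5, Store 2 5 6, Sub 5 5 1])"

text \<open>Array 1 already holds the numerators and will represent \<open>B\<close>; only
  \<open>C\<close> needs a copy. Register 5 is both counter and address and runs down to 1, so cell
  0 is untouched. A pass is charged at most 13 words: three for each of the four instructions of the
  body, counting the final \<open>Copy 0 0\<close> of \<open>seqs\<close>, and one for the
  test.\<close>

lemma copy_loop:
  assumes "s 5 = int q" "s 1 = 1" "int q \<le> N" "1 \<le> N" "s 0 = 0"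
    and "\<And>k. k \<le> q \<Longrightarrow> \<bar>m 1 k\<bar> \<le> N"
  shows "\<exists>t s'. t \<le> Suc q * (13 * word_size N) \<and>
    exec copy_loop (s, m) t (s', m(2 := (\<lambda>k. if 1 \<le> k \<and> k \<le> q then m 1 k else m 2 k))) \<and>
    (\<forall>x. x \<noteq> 5 \<and> x \<noteq> 6 \<longrightarrow> s' x = s x)"
  using assms
proof (induction q arbitrary: s m)
  case 0
  have "m(2 := (\<lambda>k. if 1 \<le> k \<and> k \<le> 0 then m 1 k else m 2 k)) = m"
    by (auto simp: fun_eq_iff)
  moreover have "exec copy_loop (s, m) (word_size (s 5)) (s, m)"
    unfolding copy_loop_def using 0 by (intro exec_WhilePos_False) simp
  moreover have "word_size (s 5) \<le> word_size N" using 0 by (intro word_size_mono) simp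
  ultimately show ?case by (intro exI[of _ "word_size (s 5)"] exI[of _ s]) auto
next
  case (Suc q)
  let ?b = "seqs [Load 6 1 5, Store 2 5 6, Sub 5 5 1]"
  define s1 where "s1 = s(6 := m 1 (Suc q), 5 := int q)"
  define m1 where "m1 = m(2 := (m 2)(Suc q := m 1 (Suc q)))"
  have e: "eff ?b (s, m) = (s1, m1)"
    using Suc.prems by (auto simp: s1_def m1_def fun_eq_iff nat_add_distrib)
  have "safe N ?b (s, m)"
    using Suc.prems Suc.prems(6)[of "Suc q"] by (simp add: nat_add_distrib)
  from exec_eff[OF this] obtain t1 where
    t1: "t1 \<le> 12 * word_size N" "exec ?b (s, m) t1 (s1, m1)" unfolding e by auto
  have m11: "m1 (Suc 0) = m (Suc 0)" by (simp add: m1_def)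
  have "\<exists>t s'. t \<le> Suc q * (13 * word_size N) \<and>
    exec copy_loop (s1, m1) t (s', m1(2 := (\<lambda>k. if 1 \<le> k \<and> k \<le> q then m1 1 k else m1 2 k))) \<and>
    (\<forall>x. x \<noteq> 5 \<and> x \<noteq> 6 \<longrightarrow> s' x = s1 x)"
    using Suc.prems by (intro Suc.IH) (auto simp: s1_def m11)
  then obtain t2 s2 where t2: "t2 \<le> Suc q * (13 * word_size N)"
    "exec copy_loop (s1, m1) t2 (s2, m1(2 := (\<lambda>k. if 1 \<le> k \<and> k \<le> q then m1 1 k else m1 2 k)))"
    "\<forall>x. x \<noteq> 5 \<and> x \<noteq> 6 \<longrightarrow> s2 x = s1 x" by blast
  have "m1(2 := (\<lambda>k. if 1 \<le> k \<and> k \<le> q then m1 1 k else m1 2 k)) =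
      m(2 := (\<lambda>k. if 1 \<le> k \<and> k \<le> Suc q then m 1 k else m 2 k))"
    by (auto simp: m1_def fun_eq_iff le_Suc_eq)
  note t2' = t2(2)[unfolded this]
  have w: "word_size (s 5) \<le> word_size N" using Suc.prems by (intro word_size_mono) simp
  show ?case
  proof (intro exI conjI)
    show "word_size (s 5) + t1 + t2 \<le> Suc (Suc q) * (13 * word_size N)"
      using w t1(1) t2(1) by simp
    show "exec copy_loop (s, m) (word_size (s 5) + t1 + t2)
        (s2, m(2 := (\<lambda>k. if 1 \<le> k \<and> k \<le> Suc q then m 1 k else m 2 k)))"
      using t1(2) t2' Suc.prems(1) unfolding copy_loop_def by (intro exec_WhilePos_True) auto
    show "\<forall>x. x \<noteq> 5 \<and> x \<noteq> 6 \<longrightarrow> s2 x = s x" using t2(3) by (auto simp: s1_def)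
  qed
qed

text \<open>Registers: 2, 3, 4 are \<open>n, f\<close> and the length of \<open>ks\<close>; 8 and 10 are \<open>s\<close> and \<open>a\<close>; 12 and 14 are
  the parts \<open>u, v\<close> of the Gaussian integer of norm \<open>2 ^ f\<close>; 15 is \<open>s a\<close>.\<close>

definition encoder_read :: com where
  "encoder_read = seqs [Const 1 1, Load 2 0 1, Const 16 3, Load 3 0 16, Load 4 1 0, Copy 5 4]"

text \<open>Subtracting \<open>s\<close> instead of 1 from \<open>f\<close> makes the shift distance
  0 at \<open>f = 0\<close>. Register 13 is the parity of \<open>f\<close>. A conditional copy
  replaces the product \<open>s * a\<close>; registers 8, 14 and 15 otherwise keep their initial
  zero.\<close>

definition encoder_params :: com where
  "encoder_params = seqs [IfPos 3 (Const 8 1) skip, Sub 9 3 8, Shl 10 1 9, Shr 11 3 1, Shl 12 1 11,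
    Sub 13 3 11, Sub 13 13 11, IfPos 13 (Copy 14 12) skip, IfPos 8 (Copy 15 10) skip]"

text \<open>Register 4 runs over the cells behind the numerators and ends as the length of both
  representations. Array 0, read before, receives the two column counts.\<close>

definition encoder_write :: com where
  "encoder_write = seqs [Add 4 4 1, Store 1 4 8, Store 2 4 8, Add 4 4 1, Store 1 4 10, Store 2 4 0,
    Add 4 4 1, Store 1 4 12, Store 2 4 10, Add 4 4 1, Store 1 4 14, Store 2 4 15,
    Add 4 4 1, Store 1 4 0, Store 2 4 1, Store 1 0 4, Store 2 0 4,
    Add 2 2 2, Const 16 2, Store 0 1 2, Store 0 16 2, Store 0 0 16]"

definition encoder :: com where
  "encoder = Seq encoder_read (Seq copy_loop (Seq encoder_params encoder_write))"

text \<open>In the notation of the overview, \<open>w = 1 + scale f * \<i>\<close> and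
  \<open>a = shift f\<close>; the truncated \<open>f - 1\<close> gives \<open>a = 1\<close> at
  \<open>f = 0\<close>. The Gaussian integer of norm \<open>2 ^ f\<close> is a power of 2, times
  \<open>1 + \<i>\<close> if \<open>f\<close> is odd.\<close>

definition scale :: "nat \<Rightarrow> int" where "scale f = of_bool (f > 0)"
definition shift :: "nat \<Rightarrow> int" where "shift f = 2 ^ (f - 1)"
definition root_re :: "nat \<Rightarrow> int" where "root_re f = 2 ^ (f div 2)"
definition root_im :: "nat \<Rightarrow> int" where "root_im f = (if odd f then 2 ^ (f div 2) else 0)"

text \<open>Up to the denominator, the even columns of \<open>B\<close> are
  \<open>w (x\<^sub>j + a e\<^sub>j)\<close>, and \<open>g = 0\<close> keeps an odd column only at
  odd diagonal entries of \<open>K\<close>, which yields \<open>2 ^ f D\<close>. In \<open>C\<close>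
  the even columns are \<open>w x\<^sub>j\<close>, and \<open>g = 1\<close> keeps every odd column
  \<open>w a e\<^sub>j\<close>.\<close>

definition rep_B :: "nat \<Rightarrow> int list \<Rightarrow> int list" where
  "rep_B f ks = ks @ [scale f, shift f, root_re f, root_im f, 0]"
definition rep_C :: "nat \<Rightarrow> int list \<Rightarrow> int list" where
  "rep_C f ks = ks @ [scale f, 0, shift f, scale f * shift f, 1]"

lemma encoder_correct:
  fixes N :: int
  assumes bnd: "\<And>z. z \<in> set ks \<Longrightarrow> \<bar>z\<bar> \<le> N"
    and N: "int (length ks) + 5 \<le> N" "2 * int n \<le> N" "int f \<le> N" "2 ^ f \<le> N"
  shows "\<exists>t \<le> Suc (length ks) * ((com_length encoder * 3 + 13) * word_size N).
    runs encoder [[int n, int l, int f], ks] [[2 * int n, 2 * int n], rep_B f ks, rep_C f ks] t"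
proof -
  define L where "L = length ks"
  define s0 :: "nat \<Rightarrow> int" where "s0 = (\<lambda>_. 0)"
  define m0 where
    "m0 = (\<lambda>a. array_of (if a < Suc (Suc 0) then [[int n, int l, int f], ks] ! a else []))"
  have init: "init_state [[int n, int l, int f], ks] = (s0, m0)"
    by (simp add: init_state_def s0_def m0_def)
  have s0: "\<And>x. s0 x = 0" by (simp add: s0_def)
  have m0: "m0 0 0 = 3" "m0 0 (Suc 0) = int n" "m0 0 3 = int f" "m0 (Suc 0) = array_of ks" "m0 2 k = 0"
    "array_of ks 0 = int (length ks)" for k
    by (auto simp: m0_def array_of_def numeral_3_eq_3 numeral_2_eq_2)
  have N1: "1 \<le> N" "2 \<le> N" "3 \<le> N" "5 \<le> N" "0 \<le> N" "int L \<le> N" "int n \<le> N" "int f \<le> N" "int L + 1 \<le> N" "2 + int L \<le> N" "3 + int L \<le> N"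
    "4 + int L \<le> N" "5 + int L \<le> N" "2 * int n \<le> N"
    using N by (auto simp: L_def)
  have ks: "\<bar>array_of ks k\<bar> \<le> N" for k
    using bnd[of "ks ! (k - 1)"] N1 by (auto simp: array_of_def L_def)
  define s1 where "s1 = fst (eff encoder_read (s0, m0))"
  have e1: "eff encoder_read (s0, m0) = (s1, m0)" by (simp add: s1_def encoder_read_def)
  have s1: "s1 0 = 0" "s1 (Suc 0) = 1" "s1 2 = int n" "s1 3 = int f" "s1 4 = int L" "s1 5 = int L"
    "s1 8 = 0" "s1 14 = 0" "s1 15 = 0"
    unfolding s1_def by (simp_all add: encoder_read_def s0 m0 L_def)
  have "safe N encoder_read (s0, m0)"
    using N1 by (simp add: encoder_read_def s0 m0 L_def)
  from exec_eff[OF this] obtain t1 where t1: "t1 \<le> com_length encoder_read * (3 * word_size N)"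
    "exec encoder_read (s0, m0) t1 (s1, m0)" unfolding e1 by auto
  define m2 where "m2 = m0(2 := (\<lambda>k. if 1 \<le> k \<and> k \<le> L then m0 1 k else m0 2 k))"
  have "\<exists>t s'. t \<le> Suc L * (13 * word_size N) \<and> exec copy_loop (s1, m0) t (s', m2) \<and>
    (\<forall>x. x \<noteq> 5 \<and> x \<noteq> 6 \<longrightarrow> s' x = s1 x)"
    unfolding m2_def by (intro copy_loop) (use s1 N1 ks m0 in auto)
  then obtain t2 s2 where t2: "t2 \<le> Suc L * (13 * word_size N)" "exec copy_loop (s1, m0) t2 (s2, m2)"
    and s2': "\<forall>x. x \<noteq> 5 \<and> x \<noteq> 6 \<longrightarrow> s2 x = s1 x" by blast
  have s2: "s2 0 = 0" "s2 (Suc 0) = 1" "s2 2 = int n" "s2 3 = int f" "s2 4 = int L"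
    "s2 8 = 0" "s2 14 = 0" "s2 15 = 0"
    using s1 s2' by auto
  define s3 where "s3 = fst (eff encoder_params (s2, m2))"
  have e3: "eff encoder_params (s2, m2) = (s3, m2)" by (simp add: s3_def encoder_params_def)
  define g p where "g = f div 2" and "p = f mod 2"
  have f: "f = 2 * g + p" and p: "p = 0 \<or> p = 1" unfolding g_def p_def by auto
  have "(2::int) ^ q \<le> N" if "q \<le> f" for q
    using power_increasing[OF that, of "2::int"] N(4) by linarith
  then have pw: "(2::int) ^ (f - Suc 0) \<le> N" "(2::int) ^ g \<le> N" by (simp_all add: g_def)
  have "safe N encoder_params (s2, m2) \<and> s3 0 = 0 \<and> s3 (Suc 0) = 1 \<and> s3 2 = int n \<and> s3 4 = int L \<and>
    s3 8 = scale f \<and> s3 10 = shift f \<and> s3 12 = root_re f \<and> s3 14 = root_im f \<and>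
    s3 15 = scale f * shift f"
  proof -
    have D: "int f div 2 = int g" "nat (int f - 1) = f - 1" "int f - int g - int g = int p"
      "\<bar>int f - int g\<bar> \<le> N" "int g \<le> N" "int f - 1 \<le> N" "int p \<le> N"
      using f p N(3) by (auto simp: nat_diff_distrib)
    have root: "root_re f = 2 ^ g" "root_im f = (if p = 1 then 2 ^ g else 0)"
      unfolding root_re_def root_im_def g_def p_def by (auto simp: odd_iff_mod_2_eq_one)
    show ?thesis
    proof (cases "f = 0")
      case True
      then have "g = 0" "p = 0" by (auto simp: g_def p_def)
      with True show ?thesis
        unfolding s3_def root by (simp add: encoder_params_def s2 N1 scale_def shift_def)
    next
      case False
      then show ?thesis
        using p unfolding s3_def root
        by (elim disjE) (simp_all add: encoder_params_def s2 D N1 N(3) pw scale_def shift_def)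
    qed
  qed
  then have sf3: "safe N encoder_params (s2, m2)"
    and s3: "s3 0 = 0" "s3 (Suc 0) = 1" "s3 2 = int n" "s3 4 = int L"
    "s3 8 = scale f" "s3 10 = shift f" "s3 12 = root_re f" "s3 14 = root_im f"
    "s3 15 = scale f * shift f" by auto
  from exec_eff[OF sf3] obtain t3 where t3: "t3 \<le> com_length encoder_params * (3 * word_size N)"
    "exec encoder_params (s2, m2) t3 (s3, m2)" unfolding e3 by auto
  have pn: "\<bar>scale f\<bar> \<le> N" "\<bar>shift f\<bar> \<le> N" "\<bar>root_re f\<bar> \<le> N" "\<bar>root_im f\<bar> \<le> N" "\<bar>scale f * shift f\<bar> \<le> N"
    using pw N1 by (auto simp: scale_def shift_def root_re_def root_im_def g_def)
  have "safe N encoder_write (s3, m2)"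
    by (simp add: encoder_write_def s3) (simp add: N1 pn)
  from exec_eff[OF this] obtain t4 s4 m4 where t4: "t4 \<le> com_length encoder_write * (3 * word_size N)"
    "exec encoder_write (s3, m2) t4 (s4, m4)" and e4: "eff encoder_write (s3, m2) = (s4, m4)"
    by (cases "eff encoder_write (s3, m2)") auto
  have nat: "nat (int L + 1) = L + 1" "nat (2 + int L) = L + 2" "nat (3 + int L) = L + 3" "nat (4 + int L) = L + 4"
    "nat (5 + int L) = L + 5" by arith+
  have m4: "m4 0 = (m2 0)(Suc 0 := 2 * int n, 2 := 2 * int n, 0 := 2)"
    "m4 (Suc 0) = (m2 1)(L + 1 := scale f, L + 2 := shift f, L + 3 := root_re f, L + 4 := root_im f,
       L + 5 := 0, 0 := int L + 5)"
    "m4 2 = (m2 2)(L + 1 := scale f, L + 2 := 0, L + 3 := shift f, L + 4 := scale f * shift f,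
       L + 5 := 1, 0 := int L + 5)"
    using e4 by (auto simp: encoder_write_def s3 nat)
  have pos: "k = 0 \<or> 1 \<le> k \<and> k \<le> L \<or> k = L + 1 \<or> k = L + 2 \<or> k = L + 3 \<or> k = L + 4 \<or> k = L + 5"
    if "k \<le> L + 5" for k using that by arith
  have out0: "m4 0 k = array_of [2 * int n, 2 * int n] k" if "k \<le> 2" for k
  proof -
    have "k = 0 \<or> k = 1 \<or> k = 2" using that by auto
    then show ?thesis by (auto simp: m4 array_of_def)
  qed
  have out1: "m4 1 k = array_of (rep_B f ks) k" if "k \<le> L + 5" for k
    using pos[OF that] by (elim disjE) (auto simp: m4 m2_def m0 rep_B_def array_of_def L_def nth_append)
  have out2: "m4 2 k = array_of (rep_C f ks) k" if "k \<le> L + 5" for k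
    using pos[OF that] by (elim disjE) (auto simp: m4 m2_def m0 rep_C_def array_of_def L_def nth_append)
  have ex: "exec encoder (s0, m0) (t1 + (t2 + (t3 + t4))) (s4, m4)"
    unfolding encoder_def using t1(2) t2(2) t3(2) t4(2) by (intro exec_Seq)
  \<comment> \<open>The loop-free phases have a number of instructions independent of
    \<open>L\<close>, so the factor \<open>Suc L\<close> of the loop absorbs them.\<close>
  have "t1 + (t3 + t4) \<le> com_length encoder * (3 * word_size N)"
    using t1(1) t3(1) t4(1) by (simp add: encoder_def algebra_simps)
  also have "\<dots> \<le> Suc L * (com_length encoder * (3 * word_size N))" by simp
  finally have "t1 + (t2 + (t3 + t4)) \<le> Suc L * ((com_length encoder * 3 + 13) * word_size N)"
    using t2(1) by (simp add: algebra_simps)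
  moreover have "m4 a k = array_of ([[2 * int n, 2 * int n], rep_B f ks, rep_C f ks] ! a) k"
    if "a < 3" "k \<le> length ([[2 * int n, 2 * int n], rep_B f ks, rep_C f ks] ! a)" for a k
  proof -
    have "a = 0 \<or> a = 1 \<or> a = 2" using that by auto
    then show ?thesis using that(2) out0[of k] out1[of k] out2[of k]
      by (auto simp: rep_B_def rep_C_def L_def)
  qed
  then have "runs encoder [[int n, int l, int f], ks] [[2 * int n, 2 * int n], rep_B f ks, rep_C f ks]
      (t1 + (t2 + (t3 + t4)))"
    unfolding runs_def init using ex by (intro exI[of _ s4] exI[of _ m4]) auto
  ultimately show ?thesis unfolding L_def by blast
qed

section \<open>Gram matrices and the exact decomposition\<close>

definition rep_mat :: "nat \<Rightarrow> nat \<Rightarrow> int list \<Rightarrow> int \<Rightarrow> int \<Rightarrow> int \<Rightarrow> int \<Rightarrow> int \<Rightarrow> complex mat" where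
  "rep_mat n f ks s \<alpha> u v g = mat n (2 * n) (\<lambda>(i, c).
     Complex (of_int (fst (entry ks s \<alpha> u v g i c)) / 2 ^ f)
             (of_int (snd (entry ks s \<alpha> u v g i c)) / 2 ^ f))"

definition mat_B :: "nat \<Rightarrow> nat \<Rightarrow> int list \<Rightarrow> complex mat" where
  "mat_B n f ks = rep_mat n f ks (scale f) (shift f) (root_re f) (root_im f) 0"

definition mat_C :: "nat \<Rightarrow> nat \<Rightarrow> int list \<Rightarrow> complex mat" where
  "mat_C n f ks = rep_mat n f ks (scale f) 0 (shift f) (scale f * shift f) 1"

lemma sum_even_odd:
  fixes F :: "nat \<Rightarrow> 'a :: comm_monoid_add"
  shows "(\<Sum>c<2 * n. F c) = (\<Sum>j<n. F (2 * j) + F (Suc (2 * j)))"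
  by (induction n) (auto simp: algebra_simps)

text \<open>This is \<open>|w|\<^sup>2 a = 2 ^ f\<close>, where
  \<open>|w|\<^sup>2 = 1 + scale f\<close> because \<open>scale f\<close> is 0 or 1.\<close>

lemma scale_shift: "(1 + scale f) * shift f = 2 ^ f"
  by (cases f) (auto simp: scale_def shift_def)

lemma root_norm: "root_re f * root_re f + root_im f * root_im f = 2 ^ f"
proof (cases "even f")
  case True
  then obtain g where "f = 2 * g" by blast
  then show ?thesis by (simp add: root_re_def root_im_def flip: power_add mult_2)
next
  case False
  then obtain g where "f = 2 * g + 1" by (rule oddE)
  then show ?thesis by (simp add: root_re_def root_im_def flip: power_add mult_2)
qed

text \<open>The matrix \<open>X\<close> of the overview.\<close>

definition half :: "int list \<Rightarrow> nat \<Rightarrow> nat \<Rightarrow> int" where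
  "half ks i j = (if i < j then ks ! (i + j) else if i = j then ks ! (i + j) div 2 else 0)"

abbreviation delta :: "nat \<Rightarrow> nat \<Rightarrow> int" where "delta i j \<equiv> (if i = j then 1 else 0)"

text \<open>Columns \<open>2 * j\<close> and \<open>2 * j + 1\<close> are taken together. Each is a
  complex scalar times an integer vector, so its contribution is real; the squared moduli of the
  scalars are \<open>1 + s\<close>, as \<open>s * s = s\<close>, and
  \<open>u * u + v * v\<close>.\<close>

lemma rep_mat_gram:
  assumes i: "i < n" and k: "k < n" and s: "s = 0 \<or> s = 1"
  shows "(rep_mat n f ks s \<alpha> u v g * mat_adjoint (rep_mat n f ks s \<alpha> u v g)) $$ (i, k) =
    complex_of_real (of_int (\<Sum>j<n. (1 + s) * (half ks i j + \<alpha> * delta i j) * (half ks k j + \<alpha> * delta k j) +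
      (if ks ! (j + j) mod 2 + g > 0 then u * u + v * v else 0) * delta i j * delta k j) / (2 ^ f * 2 ^ f))"
proof -
  let ?M = "rep_mat n f ks s \<alpha> u v g"
  have d: "dim_row ?M = n" "dim_col ?M = 2 * n" by (simp_all add: rep_mat_def)
  have even: "?M $$ (i, 2 * j) = Complex (of_int (half ks i j + \<alpha> * delta i j) / 2 ^ f)
      (of_int (s * (half ks i j + \<alpha> * delta i j)) / 2 ^ f)" if "i < n" "j < n" for i j
    using that s by (auto simp: rep_mat_def entry_def half_def Let_def)
  have odd: "?M $$ (i, Suc (2 * j)) =
      (if i = j \<and> ks ! (j + j) mod 2 + g > 0 then Complex (of_int u / 2 ^ f) (of_int v / 2 ^ f) else 0)"
    if "i < n" "j < n" for i j
    using that by (auto simp: rep_mat_def entry_def Let_def complex_eq_iff)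
  have "(?M * mat_adjoint ?M) $$ (i, k) = (\<Sum>c<2 * n. ?M $$ (i, c) * cnj (?M $$ (k, c)))"
    using i k d by (simp add: mat_adjoint_def scalar_prod_def atLeast0LessThan mat_of_rows_def)
  also have "\<dots> = (\<Sum>j<n. ?M $$ (i, 2 * j) * cnj (?M $$ (k, 2 * j)) +
      ?M $$ (i, Suc (2 * j)) * cnj (?M $$ (k, Suc (2 * j))))"
    by (rule sum_even_odd)
  also have "\<dots> = (\<Sum>j<n. complex_of_real (of_int ((1 + s) * (half ks i j + \<alpha> * delta i j) * (half ks k j + \<alpha> * delta k j) +
      (if ks ! (j + j) mod 2 + g > 0 then u * u + v * v else 0) * delta i j * delta k j) / (2 ^ f * 2 ^ f)))"
  proof (rule sum.cong[OF refl])
    fix j assume "j \<in> {..<n}"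
    then have j: "j < n" by simp
    define x y where "x = half ks i j + \<alpha> * delta i j" and "y = half ks k j + \<alpha> * delta k j"
    have "?M $$ (i, 2 * j) * cnj (?M $$ (k, 2 * j)) = complex_of_real (of_int ((1 + s) * x * y) / (2 ^ f * 2 ^ f))"
      unfolding even[OF i j] even[OF k j] x_def[symmetric] y_def[symmetric]
      using s by (auto simp: complex_eq_iff add_divide_distrib)
    moreover have "?M $$ (i, Suc (2 * j)) * cnj (?M $$ (k, Suc (2 * j))) =
      complex_of_real (of_int ((if ks ! (j + j) mod 2 + g > 0 then u * u + v * v else 0) * delta i j * delta k j) / (2 ^ f * 2 ^ f))"
      unfolding odd[OF i j] odd[OF k j]
      by (auto simp: complex_eq_iff add_divide_distrib)
    ultimately show "?M $$ (i, 2 * j) * cnj (?M $$ (k, 2 * j)) +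
      ?M $$ (i, Suc (2 * j)) * cnj (?M $$ (k, Suc (2 * j))) =
      complex_of_real (of_int ((1 + s) * (half ks i j + \<alpha> * delta i j) * (half ks k j + \<alpha> * delta k j) +
      (if ks ! (j + j) mod 2 + g > 0 then u * u + v * v else 0) * delta i j * delta k j) / (2 ^ f * 2 ^ f))"
      unfolding x_def y_def of_int_add add_divide_distrib by simp
  qed
  finally show ?thesis by (simp only: of_real_sum of_int_sum sum_divide_distrib)
qed

lemma decomposition:
  assumes i: "i < n" and k: "k < n"
  shows "(mat_B n f ks * mat_adjoint (mat_B n f ks)) $$ (i, k) -
    (mat_C n f ks * mat_adjoint (mat_C n f ks)) $$ (i, k) = complex_of_real (of_int (ks ! (i + k)) / 2 ^ f)"
proof -
  let ?X = "half ks" and ?a = "shift f" and ?s = "scale f"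
  have s: "?s = 0 \<or> ?s = 1" by (cases "f = 0") (simp_all add: scale_def)
  have norm: "?a * ?a + ?s * ?a * (?s * ?a) = (1 + ?s) * ?a * ?a"
    using s by (elim disjE) (auto simp: algebra_simps)
  \<comment> \<open>For each \<open>j\<close> the products of two entries of \<open>X\<close> cancel
    between \<open>B\<close> and \<open>C\<close>, the square of the shift cancels against the odd
    column of \<open>C\<close>, and the cross terms carry
    \<open>(1 + ?s) * ?a = 2 ^ f\<close>.\<close>
  have "((1 + ?s) * (?X i j + ?a * delta i j) * (?X k j + ?a * delta k j) +
      (if ks ! (j + j) mod 2 + 0 > 0 then root_re f * root_re f + root_im f * root_im f else 0) *
        delta i j * delta k j) -
    ((1 + ?s) * (?X i j + 0 * delta i j) * (?X k j + 0 * delta k j) +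
      (if ks ! (j + j) mod 2 + 1 > 0 then ?a * ?a + ?s * ?a * (?s * ?a) else 0) *
        delta i j * delta k j) =
    2 ^ f * (?X i j * delta k j + ?X k j * delta i j + (ks ! (j + j) mod 2) * delta i j * delta k j)" for j
  proof -
    have "(if ks ! (j + j) mod 2 + 0 > 0 then 2 ^ f else 0) = 2 ^ f * (ks ! (j + j) mod 2)"
      using mod2_eq_if[of "ks ! (j + j)"] by auto
    moreover have "ks ! (j + j) mod 2 + 1 > 0" by (smt (verit) pos_mod_sign)
    ultimately show ?thesis
      unfolding root_norm norm scale_shift[symmetric] by (simp add: algebra_simps)
  qed
  then have "(\<Sum>j<n. (1 + ?s) * (?X i j + ?a * delta i j) * (?X k j + ?a * delta k j) +
      (if ks ! (j + j) mod 2 + 0 > 0 then root_re f * root_re f + root_im f * root_im f else 0) *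
        delta i j * delta k j) -
    (\<Sum>j<n. (1 + ?s) * (?X i j + 0 * delta i j) * (?X k j + 0 * delta k j) +
      (if ks ! (j + j) mod 2 + 1 > 0 then ?a * ?a + ?s * ?a * (?s * ?a) else 0) *
        delta i j * delta k j) =
    (\<Sum>j<n. 2 ^ f * (?X i j * delta k j + ?X k j * delta i j + (ks ! (j + j) mod 2) * delta i j * delta k j))"
    by (simp only: sum_subtractf[symmetric])
  also have "\<dots> = 2 ^ f * ((\<Sum>j<n. ?X i j * delta k j) + (\<Sum>j<n. ?X k j * delta i j) +
     (\<Sum>j<n. (ks ! (j + j) mod 2) * delta i j * delta k j))"
    by (simp only: sum.distrib sum_distrib_left distrib_left)
  also have "\<dots> = 2 ^ f * (?X i k + ?X k i + (ks ! (i + i) mod 2) * delta i k)"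
    using i k by (simp add: if_distrib cong: if_cong)
  \<comment> \<open>Off the diagonal one of the two values of \<open>half\<close> vanishes and the
    other is the entry; on it, twice the quotient plus the remainder restores the entry.\<close>
  also have "\<dots> = 2 ^ f * ks ! (i + k)"
    by (auto simp: half_def add.commute)
  finally show ?thesis
    unfolding mat_B_def mat_C_def rep_mat_gram[OF i k s]
    by (simp only: of_real_diff[symmetric] diff_divide_distrib[symmetric] of_int_diff[symmetric]) simp
qed

section \<open>Sizes of entries and of representations\<close>

text \<open>Halving the diagonal makes room for the shift: \<open>k div 2\<close> is at most
  \<open>(P - 1) / 2\<close> and \<open>\<alpha>\<close> at most \<open>P / 2\<close>. From below,
  \<open>0 \<le> \<alpha>\<close> suffices.\<close>

lemma entry_bound:
  fixes P :: int
  assumes len: "length ks = 2 * n - 1" and ks: "\<And>z. z \<in> set ks \<Longrightarrow> \<bar>z\<bar> < P"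
    and \<alpha>: "0 \<le> \<alpha>" "2 * \<alpha> \<le> P" and uv: "\<bar>u\<bar> < P" "\<bar>v\<bar> < P" and i: "i < n" and c: "c < 2 * n"
  shows "\<bar>fst (entry ks s \<alpha> u v g i c)\<bar> < P \<and> \<bar>snd (entry ks s \<alpha> u v g i c)\<bar> < P"
proof -
  define j where "j = c div 2"
  have ij: "i + j < length ks" using i c len unfolding j_def by linarith
  define k where "k = ks ! (i + j)"
  have k: "\<bar>k\<bar> < P" unfolding k_def using ij by (intro ks) simp
  have k2: "\<bar>k div 2 + \<alpha>\<bar> < P" using k \<alpha> by presburger
  have P: "0 < P" using k by arith
  have kk: "i = j \<Longrightarrow> ks ! (j + j) = k" by (simp add: k_def)
  show ?thesis
    using k k2 P uv kk by (simp add: entry_def Let_def j_def[symmetric] k_def[symmetric])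
qed

lemma bit_complexity_rep_mat:
  assumes "length ks = 2 * n - 1" and "\<And>z. z \<in> set ks \<Longrightarrow> \<bar>z\<bar> < 2 ^ l"
    and "0 \<le> \<alpha>" "2 * \<alpha> \<le> 2 ^ l" and "\<bar>u\<bar> < 2 ^ l" "\<bar>v\<bar> < 2 ^ l"
  shows "bit_complexity l f (rep_mat n f ks s \<alpha> u v g)"
  using entry_bound[OF assms(1,2,3,4,5,6)]
  by (auto simp: bit_complexity_def fixed_point_def rep_mat_def)

lemma represents_rep_mat:
  fixes N :: int
  assumes "length ks = 2 * n - 1" "n \<ge> 1"
    and "\<And>z. z \<in> set (ks @ [s, \<alpha>, u, v, g]) \<Longrightarrow> 2 * \<bar>z\<bar> \<le> N"
    and "4 * int n + 4 \<le> N"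
    and q: "real (com_length decoder * (3 * word_size N)) \<le> q"
  shows "represents decoder f q (ks @ [s, \<alpha>, u, v, g]) (rep_mat n f ks s \<alpha> u v g)"
  unfolding represents_def
proof (intro allI impI)
  fix i c
  assume "i < dim_row (rep_mat n f ks s \<alpha> u v g)" "c < dim_col (rep_mat n f ks s \<alpha> u v g)"
  then have i: "i < n" and c: "c < 2 * n" by (simp_all add: rep_mat_def)
  obtain t where t: "t \<le> com_length decoder * (3 * word_size N)"
    "runs decoder [ks @ [s, \<alpha>, u, v, g], [int i, int c]]
      [[fst (entry ks s \<alpha> u v g i c), snd (entry ks s \<alpha> u v g i c)]] t"
    using decoder_correct[OF assms(1,2) i c assms(3,4)] by blast
  have "real t \<le> q" using t(1) q by linarith
  with t(2) i c show "\<exists>x y t. rep_mat n f ks s \<alpha> u v g $$ (i, c) =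
      Complex (of_int x / 2 ^ f) (of_int y / 2 ^ f) \<and>
      runs decoder [ks @ [s, \<alpha>, u, v, g], [int i, int c]] [[x, y]] t \<and> real t \<le> q"
    by (intro exI conjI) (auto simp: rep_mat_def)
qed

lemma rep_size_le:
  assumes "\<And>z. z \<in> set r \<Longrightarrow> \<bar>z\<bar> \<le> N"
  shows "rep_size r \<le> length r * word_size N"
  using assms unfolding rep_size_def
  by (induction r) (auto intro!: add_mono word_size_mono)

section \<open>Soft-O bounds\<close>

text \<open>Bounds the size of the word \<open>2 ^ l * (8 * n)\<close>: the constant 5 is
  \<open>log 2 8\<close> plus one for the leading digit and one for the sign.\<close>

definition word_bound :: "nat \<Rightarrow> nat \<Rightarrow> real" where
  "word_bound n l = real l + 5 + log 2 (real n)"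

lemma word_size_le_word_bound:
  assumes "n \<ge> 1"
  shows "real (word_size (2 ^ l * (8 * int n))) \<le> word_bound n l"
proof -
  define x where "x = 2 ^ l * (8 * n)"
  have x: "nat \<bar>2 ^ l * (8 * int n)\<bar> = x" and x0: "x > 0"
    using assms by (auto simp: x_def abs_mult nat_mult_distrib nat_power_eq)
  have "log 2 (real x) = log 2 (2 ^ l) + (log 2 8 + log 2 (real n))"
    using assms by (simp add: x_def log_mult)
  also have "log 2 (2 ^ l) = real l" by (simp add: log_nat_power)
  also have "log 2 8 = (3::real)" using log_nat_power[of 2 2 3] by simp
  finally have lg: "log 2 (real x) = real l + 3 + log 2 (real n)" by simp
  have "real (nat \<lfloor>log 2 (real x)\<rfloor>) \<le> log 2 (real x)"
    using lg assms by (intro of_nat_floor) simp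
  then show ?thesis
    using x0 lg unfolding word_size_def x by (simp add: floorlog_def word_bound_def)
qed

text \<open>Since \<open>L\<close> is at least 1, \<open>l + 5 + log 2 n\<close> is at most
  \<open>7 * l * L\<close>: one logarithmic factor suffices. The factor \<open>h\<close> is
  \<open>n\<close> for time and size, and 1 for a query.\<close>

lemma word_bound_soft_O:
  assumes "K \<ge> 0" and g: "\<And>n l. g n l \<ge> 0"
    and le: "\<And>n l. n \<ge> 1 \<Longrightarrow> l \<ge> 1 \<Longrightarrow> h n l * real l \<le> g n l" and h: "\<And>n l. h n l \<ge> 0"
  shows "(\<lambda>n l. K * h n l * word_bound n l) \<in> soft_O g"
  unfolding soft_O_def
proof (intro CollectI exI allI impI)
  fix n l :: nat
  assume n: "n \<ge> 1" and l: "l \<ge> 1"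
  define L where "L = log 2 (real (n * l) + 1)"
  have "real n * 1 \<le> real n * real l" using l by (intro mult_left_mono) auto
  then have "real n \<le> real (n * l) + 1" by simp
  then have "log 2 (real n) \<le> L" unfolding L_def using n by (intro log_mono) auto
  moreover have "1 \<le> n * l" using n l by simp
  then have "2 \<le> real (n * l) + 1" by linarith
  then have "1 \<le> L" unfolding L_def using log_mono[of 2 2 "real (n * l) + 1"] by simp
  moreover have "1 * L \<le> real l * L" using l \<open>1 \<le> L\<close> by (intro mult_right_mono) auto
  moreover have "real l * 1 \<le> real l * L" using \<open>1 \<le> L\<close> by (intro mult_left_mono) auto
  ultimately have "word_bound n l \<le> 7 * (real l * L)" unfolding word_bound_def by linarith
  then have "K * h n l * word_bound n l \<le> K * h n l * (7 * (real l * L))"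
    using assms h by (intro mult_left_mono) auto
  also have "\<dots> = (7 * K) * (h n l * real l) * L" by simp
  also have "\<dots> \<le> (7 * K) * g n l * L"
    using le[OF n l] \<open>1 \<le> L\<close> \<open>K \<ge> 0\<close> by (intro mult_right_mono mult_left_mono) auto
  finally show "K * h n l * word_bound n l \<le> (7 * K) * g n l * log 2 (real (n * l) + 1) ^ 1"
    by (simp add: L_def)
qed

section \<open>From the fixed-point input to the conclusion\<close>

lemma hankel_numerators:
  assumes h: "h \<in> carrier_vec (2 * n - 1)" and bits: "bit_complexity l f (hankel n h)"
    and k: "k < 2 * n - 1"
  defines "ks \<equiv> map (\<lambda>x. \<lfloor>x * 2 ^ f\<rfloor>) (list_of_vec h)"
  shows "h $ k = of_int (ks ! k) / 2 ^ f" "\<bar>ks ! k\<bar> < 2 ^ l"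
proof -
  \<comment> \<open>A row in which \<open>h $ k\<close> occurs: the minimum keeps both
    \<open>i\<close> and the column \<open>k - i\<close> below \<open>n\<close>.\<close>
  define i where "i = min k (n - 1)"
  have i: "i < n" "k - i < n" "i + (k - i) = k" using k by (auto simp: i_def)
  moreover have "dim_row (hankel n h) = n" "dim_col (hankel n h) = n" by (simp_all add: hankel_def)
  ultimately have "fixed_point l f (Re (hankel n h $$ (i, k - i)))"
    using bits unfolding bit_complexity_def by simp
  then obtain z :: int where z: "h $ k = of_int z / 2 ^ f" "\<bar>z\<bar> < 2 ^ l"
    using i by (auto simp: fixed_point_def hankel_def)
  have "ks ! k = z" using h k z(1) by (simp add: ks_def list_of_vec_index)
  with z show "h $ k = of_int (ks ! k) / 2 ^ f" "\<bar>ks ! k\<bar> < 2 ^ l" by auto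
qed

theorem theorem3:
  shows "\<exists>(A::com) (D::com) (T::nat \<Rightarrow> nat \<Rightarrow> real) (S::nat \<Rightarrow> nat \<Rightarrow> real) (Q::nat \<Rightarrow> nat \<Rightarrow> real)
      (cols::nat \<Rightarrow> real).
    T \<in> soft_O (\<lambda>n l. real n * real l) \<and>
    S \<in> soft_O (\<lambda>n l. real n * real l) \<and>
    Q \<in> soft_O (\<lambda>n l. real l) \<and>
    cols \<in> O(\<lambda>n. real n * ln (real n)) \<and>
    (\<forall>(n::nat) (l::nat) (f::nat) (h::real vec).
       n \<ge> 1 \<and> l \<ge> 1 \<and> f \<le> l \<and> h \<in> carrier_vec (2 * n - 1) \<and>
       bit_complexity l f (hankel n h) \<longrightarrow>
       (\<exists>(t::nat) (rB::int list) (rC::int list) (B::complex mat) (C::complex mat).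
          runs A (hankel_input n l f h) [[int (dim_col B), int (dim_col C)], rB, rC] t \<and>
          real t \<le> T n l \<and>
          real (rep_size rB) \<le> S n l \<and> real (rep_size rC) \<le> S n l \<and>
          represents D f (Q n l) rB B \<and> represents D f (Q n l) rC C \<and>
          dim_row B = n \<and> dim_row C = n \<and>
          real (dim_col B) \<le> cols n \<and> real (dim_col C) \<le> cols n \<and>
          bit_complexity l f B \<and> bit_complexity l f C \<and>
          frobenius_norm (hankel n h - (B * mat_adjoint B - C * mat_adjoint C)) < 1 / 2 ^ l))"
proof -
  \<comment> \<open>The factor 2 comes from \<open>Suc (length ks) = 2 * n\<close>.\<close>
  define E where "E = 2 * (com_length encoder * 3 + 13)"
  let ?T = "\<lambda>n l. real E * real n * word_bound n l"
  let ?S = "\<lambda>n l. 6 * real n * word_bound n l"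
  let ?Q = "\<lambda>n l. real (3 * com_length decoder) * 1 * word_bound n l"
  let ?cols = "\<lambda>n. 2 * real n"
  have T: "?T \<in> soft_O (\<lambda>n l. real n * real l)"
    by (rule word_bound_soft_O[where h = "\<lambda>n l. real n"]) auto
  have S: "?S \<in> soft_O (\<lambda>n l. real n * real l)"
    by (rule word_bound_soft_O[where h = "\<lambda>n l. real n"]) auto
  have Q: "?Q \<in> soft_O (\<lambda>n l. real l)"
    by (rule word_bound_soft_O[where h = "\<lambda>n l. 1"]) auto
  have cols: "?cols \<in> O(\<lambda>n. real n * ln (real n))"
  \<comment> \<open>The logarithm is at least 1 from \<open>n = 3\<close> on, since
    \<open>exp 1 \<le> 3\<close>.\<close>
  proof (rule bigoI[of _ 2])
    show "\<forall>\<^sub>F n in sequentially. norm (2 * real n) \<le> 2 * norm (real n * ln (real n))"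
      using eventually_ge_at_top[of 3]
    proof eventually_elim
      case (elim n)
      have "exp 1 \<le> real n" using exp_le elim by linarith
      then have "1 \<le> ln (real n)" using elim by (simp add: ln_ge_iff)
      then have "real n * 1 \<le> real n * ln (real n)" by (intro mult_left_mono) auto
      then show ?case by simp
    qed
  qed
  have main: "\<exists>t rB rC B C.
      runs encoder (hankel_input n l f h) [[int (dim_col B), int (dim_col C)], rB, rC] t \<and>
      real t \<le> ?T n l \<and>
      real (rep_size rB) \<le> ?S n l \<and> real (rep_size rC) \<le> ?S n l \<and>
      represents decoder f (?Q n l) rB B \<and> represents decoder f (?Q n l) rC C \<and>
      dim_row B = n \<and> dim_row C = n \<and>
      real (dim_col B) \<le> ?cols n \<and> real (dim_col C) \<le> ?cols n \<and>
      bit_complexity l f B \<and> bit_complexity l f C \<and>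
      frobenius_norm (hankel n h - (B * mat_adjoint B - C * mat_adjoint C)) < 1 / 2 ^ l"
    if n: "n \<ge> 1" and l: "l \<ge> 1" and f: "f \<le> l" and h: "h \<in> carrier_vec (2 * n - 1)"
      and bits: "bit_complexity l f (hankel n h)" for n l f :: nat and h :: "real vec"
  proof -
    define ks where "ks = map (\<lambda>x. \<lfloor>x * 2 ^ f\<rfloor>) (list_of_vec h)"
    have len: "length ks = 2 * n - 1" using h by (simp add: ks_def)
    note num = hankel_numerators[OF h bits, folded ks_def]
    have ksb: "\<bar>z\<bar> < 2 ^ l" if "z \<in> set ks" for z
      using that num(2) len by (auto simp: in_set_conv_nth)
    \<comment> \<open>One bound for all words: \<open>8 * 2 ^ l\<close> covers the doubled
      numerators and parameters, \<open>16 * n\<close> the addresses.\<close>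
    define N :: int where "N = 2 ^ l * (8 * int n)"
    have w: "real (word_size N) \<le> word_bound n l"
      unfolding N_def using n by (rule word_size_le_word_bound)
    have two: "(2::int) \<le> 2 ^ l" using power_increasing[OF l, of "2::int"] by simp
    have N: "8 * 2 ^ l \<le> N" "16 * int n \<le> N"
      unfolding N_def using n two mult_left_mono[of 1 "int n" "2 ^ l"]
        mult_right_mono[of 2 "2 ^ l" "8 * int n"] by auto
    have flt: "int f < 2 ^ l" using f of_nat_less_two_power[of f, where 'a = int] power_increasing[OF f, of "2::int"]
      by linarith
    have pow: "(2::int) ^ q \<le> 2 ^ l" if "q \<le> l" for q using that by simp
    have pows: "(2::int) ^ q < 2 ^ l" if "q < l" for q using that by simp
    \<comment> \<open>For \<open>f > 0\<close>, \<open>2 * shift f = 2 ^ f\<close>; at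
      \<open>f = 0\<close> the shift is 1 and \<open>l \<ge> 1\<close> is what makes the bounds
      hold.\<close>
    have shift: "0 \<le> shift f" "2 * shift f \<le> 2 ^ l" "shift f < 2 ^ l"
      using f l two pow[of f] by (cases f; simp add: shift_def)+
    have scale: "scale f = 0 \<or> scale f = 1" by (cases "f = 0") (simp_all add: scale_def)
    have root: "\<bar>root_re f\<bar> < 2 ^ l" "\<bar>root_im f\<bar> < 2 ^ l"
      using f l pows[of "f div 2"] by (auto simp: root_re_def root_im_def)
    have Cim: "\<bar>scale f * shift f\<bar> < 2 ^ l" using scale shift by auto
    have bB: "\<bar>z\<bar> \<le> 2 ^ l" if "z \<in> set (rep_B f ks)" for z
      using that ksb[of z] scale shift root two by (auto simp: rep_B_def)
    have bC: "\<bar>z\<bar> \<le> 2 ^ l" if "z \<in> set (rep_C f ks)" for z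
      using that ksb[of z] scale shift Cim two by (auto simp: rep_C_def)
    have dims: "dim_row (mat_B n f ks) = n" "dim_row (mat_C n f ks) = n"
      "dim_col (mat_B n f ks) = 2 * n" "dim_col (mat_C n f ks) = 2 * n"
      by (simp_all add: mat_B_def mat_C_def rep_mat_def)
    have q: "real (com_length decoder * (3 * word_size N)) \<le> ?Q n l"
      using mult_left_mono[OF w, of "real (3 * com_length decoder)"] by (simp add: algebra_simps)
    have B2: "2 * \<bar>z\<bar> \<le> N" if "z \<in> set (rep_B f ks)" for z
      using bB[OF that] N(1) two by linarith
    have C2: "2 * \<bar>z\<bar> \<le> N" if "z \<in> set (rep_C f ks)" for z
      using bC[OF that] N(1) two by linarith
    have N4: "4 * int n + 4 \<le> N" using N(2) n by linarith
    have repr: "represents decoder f (?Q n l) (rep_B f ks) (mat_B n f ks)"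
      "represents decoder f (?Q n l) (rep_C f ks) (mat_C n f ks)"
      unfolding rep_B_def rep_C_def mat_B_def mat_C_def
      by (rule represents_rep_mat[OF len n B2[unfolded rep_B_def] N4 q]
            represents_rep_mat[OF len n C2[unfolded rep_C_def] N4 q], assumption)+
    have bitBC: "bit_complexity l f (mat_B n f ks)" "bit_complexity l f (mat_C n f ks)"
      unfolding mat_B_def mat_C_def using len ksb shift root Cim
      by (intro bit_complexity_rep_mat; simp)+
    have "\<exists>t \<le> Suc (length ks) * ((com_length encoder * 3 + 13) * word_size N).
      runs encoder [[int n, int l, int f], ks] [[2 * int n, 2 * int n], rep_B f ks, rep_C f ks] t"
    proof (rule encoder_correct)
      show "\<bar>z\<bar> \<le> N" if "z \<in> set ks" for z using ksb[OF that] N two by linarith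
      show "int (length ks) + 5 \<le> N" "2 * int n \<le> N" using len n N(2) by auto
      show "int f \<le> N" "2 ^ f \<le> N" using flt pow[OF f] N(1) two by linarith+
    qed
    then obtain t where t: "t \<le> Suc (length ks) * ((com_length encoder * 3 + 13) * word_size N)"
      and run: "runs encoder [[int n, int l, int f], ks] [[2 * int n, 2 * int n], rep_B f ks, rep_C f ks] t"
      by blast
    have "t \<le> E * n * word_size N" using t len n by (simp add: E_def algebra_simps)
    then have "real t \<le> real E * real n * real (word_size N)"
      by (metis of_nat_le_iff of_nat_mult)
    also have "\<dots> \<le> ?T n l" using w by (intro mult_left_mono) auto
    finally have tT: "real t \<le> ?T n l" .
    have size: "real (rep_size r) \<le> ?S n l"
      if "length r = 2 * n + 4" "\<And>z. z \<in> set r \<Longrightarrow> \<bar>z\<bar> \<le> 2 ^ l" for r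
    proof -
      have "rep_size r \<le> length r * word_size N"
        using that(2) N(1) two by (intro rep_size_le) force
      also have "\<dots> \<le> 6 * n * word_size N" using that(1) n by (intro mult_right_mono) auto
      finally have "real (rep_size r) \<le> 6 * real n * real (word_size N)"
        by (metis of_nat_le_iff of_nat_mult of_nat_numeral)
      also have "\<dots> \<le> ?S n l" using w by (intro mult_left_mono) auto
      finally show ?thesis .
    qed
    have sizes: "real (rep_size (rep_B f ks)) \<le> ?S n l" "real (rep_size (rep_C f ks)) \<le> ?S n l"
      using len n bB bC by (intro size; simp add: rep_B_def rep_C_def)+
    define R where "R = hankel n h - (mat_B n f ks * mat_adjoint (mat_B n f ks) -
      mat_C n f ks * mat_adjoint (mat_C n f ks))"
    have adj: "dim_col (mat_adjoint M) = dim_row M" for M :: "complex mat"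
      by (simp add: mat_adjoint_def)
    have dimR: "dim_row R = n" "dim_col R = n"
      by (simp_all add: R_def dims adj del: index_mult_mat(1))
    have "R $$ (i, k) = 0" if "i < n" "k < n" for i k
    proof -
      have "R $$ (i, k) = hankel n h $$ (i, k) -
          ((mat_B n f ks * mat_adjoint (mat_B n f ks)) $$ (i, k) -
           (mat_C n f ks * mat_adjoint (mat_C n f ks)) $$ (i, k))"
        unfolding R_def using that dims adj by (simp del: index_mult_mat(1))
      also have "hankel n h $$ (i, k) = complex_of_real (of_int (ks ! (i + k)) / 2 ^ f)"
        using that num(1)[of "i + k"] by (simp add: hankel_def)
      finally show ?thesis unfolding decomposition[OF that] by simp
    qed
    \<comment> \<open>The error is exactly zero, so the strict bound only needs
      \<open>1 / 2 ^ l\<close> to be positive.\<close>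
    then have "frobenius_norm R = 0" using dimR by (simp add: frobenius_norm_def)
    then have "frobenius_norm R < 1 / 2 ^ l" by simp
    then show ?thesis
      using run tT sizes repr bitBC dims
      by (intro exI[of _ t] exI[of _ "rep_B f ks"] exI[of _ "rep_C f ks"] exI[of _ "mat_B n f ks"]
          exI[of _ "mat_C n f ks"]) (simp add: hankel_input_def ks_def[symmetric] R_def[symmetric])
  qed
  show ?thesis
    by (rule exI[of _ encoder], rule exI[of _ decoder], rule exI[of _ ?T], rule exI[of _ ?S],
        rule exI[of _ ?Q], rule exI[of _ ?cols], intro conjI allI impI T S Q cols, elim conjE, rule main)
qed

end
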